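(* Let $\mathcal{K}$ be the set of all positions of misère partizan Kayles and let $n\ge 3$. Then, modulo $\mathcal{K}$, $$S_n\equiv\begin{cases} kS_1+kS_2, & \text{if } n=3k,\\ (k+1)S_1+kS_2, & \text{if } n=3k+1,\\ kS_1+(k+1)S_2, & \text{if } n=3k+2.\end{cases}$$
   Context: Partizan Kayles is played on $1\times n$ strips of squares; $S_n$ denotes an empty strip of length $n$, and $mG$ denotes the disjunctive sum of $m$ copies of $G$. Left moves by placing a single square on one empty cell; Right moves by placing a domino covering two adjacent empty cells of the same strip; a placement splits a strip into the strips of empty cells on either side. $\mathcal{K}$ is the set of all disjunctive sums of strips. Under misère play a player unable to move on their turn wins; $o^-(G)$ is the misère outcome. $G\equiv H\pmod{\mathcal{K}}$ means $o^-(G+X)=o^-(H+X)$ for all $X\in\mathcal{K}$. *)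

theory Defs
  imports Main "HOL-Library.FSet" "HOL-Library.Multiset"
begin

text \<open>Short partizan games as finite trees \<open>{G\<^sup>L | G\<^sup>R}\<close>.\<close>

datatype game = Game (left_opts: "game fset") (right_opts: "game fset")

lemma size_left_opts [termination_simp]:
  assumes "H |\<in>| left_opts G" shows "size H < size G"
proof (cases G)
  case (Game L R)
  with assms have "size H < (\<Sum>x\<in>fset L. Suc (size x))"
    by (intro less_le_trans[OF _ member_le_sum[of H]]) auto
  with Game show ?thesis by simp
qed

lemma size_right_opts [termination_simp]:
  assumes "H |\<in>| right_opts G" shows "size H < size G"
proof (cases G)
  case (Game L R)
  with assms have "size H < (\<Sum>x\<in>fset R. Suc (size x))"
    by (intro less_le_trans[OF _ member_le_sum[of H]]) auto
  with Game show ?thesis by simp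
qed

text \<open>Because options form sets, the laws of disjunctive sums hold as equalities of trees.\<close>

instantiation game :: comm_monoid_add
begin

definition zero_game :: game where
  "0 = Game {||} {||}"

function plus_game :: "game \<Rightarrow> game \<Rightarrow> game" where
  "plus_game G H = Game
     ((\<lambda>G'. plus_game G' H) |`| left_opts G |\<union>| (\<lambda>H'. plus_game G H') |`| left_opts H)
     ((\<lambda>G'. plus_game G' H) |`| right_opts G |\<union>| (\<lambda>H'. plus_game G H') |`| right_opts H)"
  by auto
termination
  by (relation "measure (\<lambda>(G, H). size G + size H)")
    (auto simp: size_left_opts size_right_opts)

declare plus_game.simps [simp del]

lemma left_opts_plus:
  "left_opts (G + H) = (\<lambda>G'. G' + H) |`| left_opts G |\<union>| (\<lambda>H'. G + H') |`| left_opts H"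
  by (subst plus_game.simps) simp

lemma right_opts_plus:
  "right_opts (G + H) = (\<lambda>G'. G' + H) |`| right_opts G |\<union>| (\<lambda>H'. G + H') |`| right_opts H"
  by (subst plus_game.simps) simp

instance
proof
  fix G H K :: game
  show "G + H + K = G + (H + K)"
  proof (induction "size G + size H + size K" arbitrary: G H K rule: less_induct)
    case less
    show ?case
      by (rule game.expand)
        (auto simp: left_opts_plus right_opts_plus fimage_funion fset.map_comp o_def
          funion_assoc less size_left_opts size_right_opts
          intro!: arg_cong2[where f = "(|\<union>|)"] fset.map_cong0)
  qed
  show "G + H = H + G"
  proof (induction "size G + size H" arbitrary: G H rule: less_induct)
    case less
    show ?case
      by (rule game.expand)
        (simp add: left_opts_plus right_opts_plus less size_left_opts size_right_opts
          funion_commute cong: fset.map_cong_simp)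
  qed
  show "0 + G = G"
  proof (induction "size G" arbitrary: G rule: less_induct)
    case less
    show ?case
      by (rule game.expand)
        (simp add: left_opts_plus right_opts_plus zero_game_def
          less[unfolded zero_game_def] size_left_opts size_right_opts
          cong: fset.map_cong_simp)
  qed
qed

end

definition copies :: "nat \<Rightarrow> game \<Rightarrow> game" where
  "copies m G = (\<Sum>i<m. G)"

text \<open>Misere play: the player who cannot move wins.\<close>

function left_wins_first right_wins_first :: "game \<Rightarrow> bool" where
  "left_wins_first G \<longleftrightarrow>
     left_opts G = {||} \<or> (\<exists>G' |\<in>| left_opts G. \<not> right_wins_first G')"
| "right_wins_first G \<longleftrightarrow>
     right_opts G = {||} \<or> (\<exists>G' |\<in>| right_opts G. \<not> left_wins_first G')"
  by pat_completeness auto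
termination
  by (relation "measure (case_sum size size)") (auto simp: size_left_opts size_right_opts)

declare left_wins_first.simps [simp del] right_wins_first.simps [simp del]

datatype outcome = LeftWins | RightWins | NextWins | PreviousWins

definition misere_outcome :: "game \<Rightarrow> outcome" where
  "misere_outcome G =
     (if left_wins_first G
      then if right_wins_first G then NextWins else LeftWins
      else if right_wins_first G then RightWins else PreviousWins)"

definition equiv_mod :: "game set \<Rightarrow> game \<Rightarrow> game \<Rightarrow> bool" where
  "equiv_mod U G H \<longleftrightarrow> (\<forall>X\<in>U. misere_outcome (G + X) = misere_outcome (H + X))"

text \<open>The index \<open>i\<close> is the number of empty cells to the left of the piece just placed.\<close>

function strip :: "nat \<Rightarrow> game" where
  "strip n = Game
     ((\<lambda>i. strip i + strip (n - 1 - i)) |`| fset_of_list [0..<n])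
     ((\<lambda>i. strip i + strip (n - 2 - i)) |`| fset_of_list [0..<n - 1])"
  by auto
termination
  by (relation "measure id") (auto simp: fset_of_list_elem)

declare strip.simps [simp del]

definition kayles :: "game set" where
  "kayles = range (\<lambda>M :: nat multiset. \<Sum>n\<in>#M. strip n)"

end

theory Submission
  imports Defs
begin

text \<open>
  Give a strip the weight 0, 1 or -1 according to its length modulo 3, and add the weights of the
  strips of a position. A Left move changes the total weight \<open>w\<close> by -1 or 2, a Right move by 1 or
  -2, so modulo 3 the course of play is forced. It follows that \<open>w\<close> determines the outcome: Left
  wins moving first iff \<open>w\<close> is a nonpositive multiple of 3, and Right loses moving first iff \<open>w\<close>
  is nonpositive and congruent to 2. Both sides of each claimed equivalence have the same weight.
\<close>

section \<open>Weights of single strips and their changes under a move\<close>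

definition weight :: "nat \<Rightarrow> int" where
  "weight n = int (Suc n mod 3) - 1"

lemma weight_simps [simp]: "weight 0 = 0" "weight (Suc 0) = 1" "weight 2 = -1"
  by (simp_all add: weight_def)

lemma weight_range: "-1 \<le> weight n" "weight n \<le> 1"
proof -
  have "Suc n mod 3 < 3" by simp
  then show "-1 \<le> weight n" "weight n \<le> 1" unfolding weight_def by linarith+
qed

text \<open>Naming the multiple of 3 turns congruences between weights into linear identities over
  the integers.\<close>

lemma weight_cong: obtains c where "weight n = int n + 3 * c"
proof -
  have "int (Suc n mod 3) = int (Suc n) - 3 * int (Suc n div 3)"
    by (simp add: minus_mult_div_eq_mod [symmetric] of_nat_diff)
  then have "weight n = int n + 3 * (- int (Suc n div 3))"
    by (simp add: weight_def)
  then show ?thesis by (rule that)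
qed

text \<open>One cell disappears, so the difference is -1 modulo 3. It lies between -3 and 3 because
  each weight lies between -1 and 1, and only two values remain.\<close>

lemma weight_split_left: "weight i + weight j - weight (i + j + 1) \<in> {-1, 2}"
proof -
  obtain a b c where "weight i = int i + 3 * a" "weight j = int j + 3 * b"
    "weight (i + j + 1) = int (i + j + 1) + 3 * c"
    by (metis weight_cong)
  then have "weight i + weight j - weight (i + j + 1) = -1 + 3 * (a + b - c)" by simp
  then obtain d where d: "weight i + weight j - weight (i + j + 1) = -1 + 3 * d" ..
  then have "0 \<le> d" "d \<le> 1"
    using weight_range[of i] weight_range[of j] weight_range[of "i + j + 1"] by linarith+
  then have "d = 0 \<or> d = 1" by linarith
  then show ?thesis using d by auto
qed

lemma weight_split_right: "weight i + weight j - weight (i + j + 2) \<in> {1, -2}"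
proof -
  obtain a b c where "weight i = int i + 3 * a" "weight j = int j + 3 * b"
    "weight (i + j + 2) = int (i + j + 2) + 3 * c"
    by (metis weight_cong)
  then have "weight i + weight j - weight (i + j + 2) = 1 + 3 * (a + b - c - 1)" by simp
  then obtain d where d: "weight i + weight j - weight (i + j + 2) = 1 + 3 * d" ..
  then have "-1 \<le> d" "d \<le> 0"
    using weight_range[of i] weight_range[of j] weight_range[of "i + j + 2"] by linarith+
  then have "d = -1 \<or> d = 0" by linarith
  then show ?thesis using d by auto
qed

text \<open>Playing at the end of the strip cannot raise the weight by 2 here, since the result
  would exceed 1.\<close>

lemma weight_remove_cell:
  assumes "n > 0" "weight n \<ge> 0"
  shows "weight (n - 1) = weight n - 1"
  using weight_split_left[of 0 "n - 1"] weight_range[of "n - 1"] assms by auto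

text \<open>Right can always raise the weight. A domino at the end does so unless the strip has
  weight 1, where it leaves weight -1. In that case leave one cell at the end: it and the remaining
  \<open>n - 3\<close> cells each have weight 1.\<close>

lemma weight_remove_domino:
  assumes "n \<ge> 2"
  obtains i where "i < n - 1" "weight i + weight (n - 2 - i) = weight n + 1"
proof (cases "weight n = 1")
  case True
  \<comment> \<open>A strip of length 2 has weight -1. Excluding it makes the index 1 legal and
    keeps \<open>n - 3\<close> from being truncated.\<close>
  then have "n \<noteq> 2" by auto
  with assms have "1 + (n - 3) + 2 = n" by simp
  with True have "weight 1 + weight (n - 2 - 1) = weight n + 1"
    using weight_split_right[of 1 "n - 3"] weight_range[of "n - 3"] by auto
  then show ?thesis using assms \<open>n \<noteq> 2\<close> by (intro that[of 1]) auto
next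
  case False
  then have "weight n \<le> 0" using weight_range[of n] by simp
  moreover have "0 + (n - 2) + 2 = n" using assms by simp
  ultimately have "weight 0 + weight (n - 2 - 0) = weight n + 1"
    using weight_split_right[of 0 "n - 2"] weight_range[of "n - 2"] weight_range[of n] False
    by auto
  then show ?thesis using assms by (intro that[of 0]) auto
qed

section \<open>Positions as multisets of strip lengths, and their options\<close>

definition position :: "nat multiset \<Rightarrow> game" where
  "position M = (\<Sum>n\<in>#M. strip n)"

text \<open>The weight belongs to the multiset because a game tree does not display its strips.
  Empty strips left by a move stay in the multiset and count 0.\<close>

definition total_weight :: "nat multiset \<Rightarrow> int" where
  "total_weight M = (\<Sum>n\<in>#M. weight n)"

lemma position_empty [simp]: "position {#} = 0"
  and position_add_mset [simp]: "position (add_mset n M) = strip n + position M"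
  and position_union: "position (M + N) = position M + position N"
  by (simp_all add: position_def)

lemma total_weight_empty [simp]: "total_weight {#} = 0"
  and total_weight_add_mset [simp]: "total_weight (add_mset n M) = weight n + total_weight M"
  and total_weight_union: "total_weight (M + N) = total_weight M + total_weight N"
  by (simp_all add: total_weight_def)

lemma total_weight_replicate: "total_weight (replicate_mset k n) = int k * weight n"
  by (induction k) (simp_all add: algebra_simps)

lemma position_replicate: "position (replicate_mset k n) = copies k (strip n)"
  by (induction k) (simp_all add: copies_def add.commute)

lemma left_opts_strip:
  "fset (left_opts (strip n)) = (\<lambda>i. strip i + strip (n - 1 - i)) ` {..<n}"
  by (subst strip.simps) (simp add: fset_of_list.rep_eq lessThan_atLeast0)

lemma right_opts_strip:
  "fset (right_opts (strip n)) = (\<lambda>i. strip i + strip (n - 2 - i)) ` {..<n - 1}"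
  by (subst strip.simps) (simp add: fset_of_list.rep_eq lessThan_atLeast0)

text \<open>A move in a sum is a move in one summand. Abstracting over \<open>opts\<close> lets one
  induction serve both players.\<close>

lemma opts_position:
  assumes zero: "opts 0 = {||}"
    and plus: "\<And>G H. opts (G + H) = (\<lambda>G'. G' + H) |`| opts G |\<union>| (\<lambda>H'. G + H') |`| opts H"
  shows "G |\<in>| opts (position M) \<longleftrightarrow>
    (\<exists>n N S. M = add_mset n N \<and> S |\<in>| opts (strip n) \<and> G = S + position N)"
proof
  assume "G |\<in>| opts (position M)"
  then show "\<exists>n N S. M = add_mset n N \<and> S |\<in>| opts (strip n) \<and> G = S + position N"
  proof (induction M arbitrary: G)
    case empty
    then show ?case by (simp add: zero)
  next
    case (add m M)
    from add.prems consider S where "S |\<in>| opts (strip m)" "G = S + position M"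
      | H where "H |\<in>| opts (position M)" "G = strip m + H"
      by (auto simp: plus)
    then show ?case
    proof cases
      case 1
      then show ?thesis by blast
    next
      case 2
      from add.IH[OF 2(1)] obtain n N S
        where "M = add_mset n N" "S |\<in>| opts (strip n)" "H = S + position N"
        by blast
      then have "add_mset m M = add_mset n (add_mset m N) \<and> S |\<in>| opts (strip n) \<and>
          G = S + position (add_mset m N)"
        using 2(2) by (simp add: ac_simps)
      then show ?thesis by blast
    qed
  qed
next
  assume "\<exists>n N S. M = add_mset n N \<and> S |\<in>| opts (strip n) \<and> G = S + position N"
  then show "G |\<in>| opts (position M)" by (auto simp: plus)
qed

lemma left_opts_position:
  "G |\<in>| left_opts (position M) \<longleftrightarrow>
    (\<exists>n i N. M = add_mset n N \<and> i < n \<and> G = position (add_mset i (add_mset (n - 1 - i) N)))"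
  unfolding opts_position[of left_opts, OF _ left_opts_plus, simplified zero_game_def, simplified]
  by (force simp: left_opts_strip add.assoc)

lemma right_opts_position:
  "G |\<in>| right_opts (position M) \<longleftrightarrow>
    (\<exists>n i N. M = add_mset n N \<and> i < n - 1 \<and> G = position (add_mset i (add_mset (n - 2 - i) N)))"
  unfolding opts_position[of right_opts, OF _ right_opts_plus, simplified zero_game_def, simplified]
  by (force simp: right_opts_strip add.assoc)

section \<open>Moves and total weight\<close>

lemma left_move_weight:
  assumes "G |\<in>| left_opts (position M)"
  obtains N where "G = position N" "total_weight N - total_weight M \<in> {-1, 2}"
proof -
  from assms obtain n i N where *: "M = add_mset n N" "i < n"
    "G = position (add_mset i (add_mset (n - 1 - i) N))"
    unfolding left_opts_position by blast
  show ?thesis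
    using * weight_split_left[of i "n - 1 - i"]
    by (intro that[of "add_mset i (add_mset (n - 1 - i) N)"]) auto
qed

lemma right_move_weight:
  assumes "G |\<in>| right_opts (position M)"
  obtains N where "G = position N" "total_weight N - total_weight M \<in> {1, -2}"
proof -
  from assms obtain n i N where *: "M = add_mset n N" "i < n - 1"
    "G = position (add_mset i (add_mset (n - 2 - i) N))"
    unfolding right_opts_position by blast
  moreover have "i + (n - 2 - i) + 2 = n"
    using * by simp
  ultimately show ?thesis
    using weight_split_right[of i "n - 2 - i"]
    by (intro that[of "add_mset i (add_mset (n - 2 - i) N)"]) auto
qed

lemma left_move_exists:
  assumes "n \<in># M" "n > 0"
  shows "left_opts (position M) \<noteq> {||}"
proof -
  from assms obtain N where "M = add_mset n N"
    by (blast dest: multi_member_split)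
  then show ?thesis
    using assms(2) left_opts_position[of _ M] by force
qed

lemma right_move_up_exists:
  assumes "n \<in># M" "n \<ge> 2"
  obtains N where "position N |\<in>| right_opts (position M)" "total_weight N = total_weight M + 1"
proof -
  from assms obtain K where K: "M = add_mset n K"
    by (blast dest: multi_member_split)
  obtain i where i: "i < n - 1" "weight i + weight (n - 2 - i) = weight n + 1"
    using weight_remove_domino[OF assms(2)] .
  show ?thesis
  proof (rule that)
    show "position (add_mset i (add_mset (n - 2 - i) K)) |\<in>| right_opts (position M)"
      unfolding right_opts_position using K i by blast
  qed (use K i in auto)
qed

lemma right_move_up:
  assumes "right_opts (position M) \<noteq> {||}"
  obtains N where "position N |\<in>| right_opts (position M)" "total_weight N = total_weight M + 1"
proof -
  from assms obtain G where "G |\<in>| right_opts (position M)" by auto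
  then obtain n where "n \<in># M" "n \<ge> 2"
    unfolding right_opts_position by force
  then show ?thesis using that by (rule right_move_up_exists)
qed

text \<open>Some strip has negative weight, which rules out lengths 0 and 1. Hence Right is never
  stuck at negative total weight.\<close>

lemma total_weight_negativeD:
  assumes "total_weight M < 0"
  obtains n where "n \<in># M" "n \<ge> 2"
proof -
  have "\<exists>n\<in>#M. weight n < 0"
    using assms by (induction M) force+
  then obtain n where "n \<in># M" "weight n < 0" by blast
  moreover from this have "n \<noteq> 0" "n \<noteq> 1" by (auto intro: ccontr)
  ultimately show ?thesis using that by auto
qed

text \<open>At weight 0 a change of 2 would be a mistake, so Left needs a move to -1: shorten a
  nonempty strip of nonnegative weight by its end cell.\<close>

lemma left_move_down:
  assumes "total_weight M = 0" "left_opts (position M) \<noteq> {||}"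
  obtains N where "position N |\<in>| left_opts (position M)" "total_weight N = -1"
proof -
  have "\<exists>n\<in>#M. n > 0 \<and> weight n \<ge> 0"
  proof (rule ccontr)
    \<comment> \<open>Otherwise every nonempty strip has negative weight. Left can move, so such a
      strip exists and the total is negative.\<close>
    assume neg: "\<not> ?thesis"
    from assms(2) obtain m where m: "m \<in># M" "m > 0"
      using left_opts_position by fastforce
    then obtain K where K: "M = add_mset m K"
      by (blast dest: multi_member_split)
    have "\<forall>n\<in>#K. weight n \<le> 0"
      using neg K by (metis gr0I linorder_le_cases union_iff add_mset_add_single weight_simps(1))
    then have "total_weight K \<le> 0"
      by (induction K) auto
    moreover have "weight m < 0" using neg m by auto
    ultimately show False using assms(1) K by simp
  qed
  then obtain n K where K: "M = add_mset n K" "n > 0" "weight n \<ge> 0"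
    by (blast dest: multi_member_split)
  show ?thesis
  proof (rule that)
    show "position (add_mset 0 (add_mset (n - 1 - 0) K)) |\<in>| left_opts (position M)"
      unfolding left_opts_position using K by blast
  qed (use K assms(1) weight_remove_cell[of n] in auto)
qed

section \<open>Outcomes\<close>

lemma first_player_wins_position:
  "left_wins_first (position M) \<longleftrightarrow> total_weight M \<le> 0 \<and> total_weight M mod 3 = 0"
  "right_wins_first (position M) \<longleftrightarrow> \<not> (total_weight M \<le> 0 \<and> total_weight M mod 3 = 2)"
proof (induction "size (position M)" arbitrary: M rule: less_induct)
  case less
  let ?w = "total_weight M"
  have IH_left: "right_wins_first (position N) \<longleftrightarrow>
      \<not> (total_weight N \<le> 0 \<and> total_weight N mod 3 = 2)"
    if "position N |\<in>| left_opts (position M)" for N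
    using size_left_opts[OF that] by (rule less(2))
  have IH_right: "left_wins_first (position N) \<longleftrightarrow>
      total_weight N \<le> 0 \<and> total_weight N mod 3 = 0"
    if "position N |\<in>| right_opts (position M)" for N
    using size_right_opts[OF that] by (rule less(1))
  show "left_wins_first (position M) \<longleftrightarrow> ?w \<le> 0 \<and> ?w mod 3 = 0"
  proof
    assume "left_wins_first (position M)"
    then consider "left_opts (position M) = {||}"
      | G where "G |\<in>| left_opts (position M)" "\<not> right_wins_first G"
      by (subst (asm) left_wins_first.simps) auto
    then show "?w \<le> 0 \<and> ?w mod 3 = 0"
    proof cases
      case 1
      \<comment> \<open>Left is stuck, and so wins, only when all strips are empty, which agrees
        with the criterion at weight 0.\<close>
      then have "\<forall>n\<in>#M. n = 0" using left_move_exists by blast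
      then have "?w = 0" by (induction M) auto
      then show ?thesis by simp
    next
      case 2
      obtain N where N: "G = position N" "total_weight N - ?w \<in> {-1, 2}"
        using left_move_weight[OF 2(1)] .
      have "total_weight N \<le> 0 \<and> total_weight N mod 3 = 2"
        using 2 IH_left[of N] unfolding N(1) by simp
      \<comment> \<open>The new weight is at most -1, being nonpositive and 2 modulo 3. The old one
        exceeds it by 1 or is 2 less, so it is a nonpositive multiple of 3.\<close>
      then show ?thesis using N(2) unfolding insert_iff empty_iff by presburger
    qed
  next
    assume w: "?w \<le> 0 \<and> ?w mod 3 = 0"
    show "left_wins_first (position M)"
    proof (cases "left_opts (position M) = {||}")
      case True
      then show ?thesis by (subst left_wins_first.simps) simp
    next
      case False
      have "\<exists>N. position N |\<in>| left_opts (position M) \<and> total_weight N \<le> 0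
          \<and> total_weight N mod 3 = 2"
      \<comment> \<open>Left has to choose a move only at weight 0. At weight -3 or below, both
        possible changes lead to a weight of at most -1, so every move wins.\<close>
      proof (cases "?w = 0")
        case True
        obtain N where "position N |\<in>| left_opts (position M)" "total_weight N = -1"
          using left_move_down[OF True False] .
        then show ?thesis by (intro exI[of _ N]) simp
      next
        case neq: False
        from False obtain G where G: "G |\<in>| left_opts (position M)" by auto
        obtain N where N: "G = position N" "total_weight N - ?w \<in> {-1, 2}"
          using left_move_weight[OF G] .
        have "total_weight N \<le> 0 \<and> total_weight N mod 3 = 2"
          using N(2) w neq unfolding insert_iff empty_iff by presburger
        then show ?thesis using G N by blast
      qed
      then show ?thesis using IH_left by (subst left_wins_first.simps) blast
    qed
  qed
  show "right_wins_first (position M) \<longleftrightarrow> \<not> (?w \<le> 0 \<and> ?w mod 3 = 2)"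
  proof
    assume "right_wins_first (position M)"
    then consider "right_opts (position M) = {||}"
      | G where "G |\<in>| right_opts (position M)" "\<not> left_wins_first G"
      by (subst (asm) right_wins_first.simps) auto
    then show "\<not> (?w \<le> 0 \<and> ?w mod 3 = 2)"
    proof cases
      case 1
      have "\<not> ?w < 0"
      proof
        assume "?w < 0"
        then obtain n where "n \<in># M" "n \<ge> 2" by (rule total_weight_negativeD)
        then show False using 1 by (metis right_move_up_exists fempty_iff)
      qed
      then show ?thesis by auto
    next
      case 2
      obtain N where N: "G = position N" "total_weight N - ?w \<in> {1, -2}"
        using right_move_weight[OF 2(1)] .
      have "\<not> (total_weight N \<le> 0 \<and> total_weight N mod 3 = 0)"
        using 2 IH_right[of N] unfolding N(1) by simp
      \<comment> \<open>From a weight of at most -1 that is 2 modulo 3, both changes, 1 and -2,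
        would reach a nonpositive multiple of 3, where Left wins.\<close>
      then show ?thesis using N(2) unfolding insert_iff empty_iff by presburger
    qed
  next
    assume w: "\<not> (?w \<le> 0 \<and> ?w mod 3 = 2)"
    show "right_wins_first (position M)"
    proof (cases "right_opts (position M) = {||}")
      case True
      then show ?thesis by (subst right_wins_first.simps) simp
    next
      case False
      \<comment> \<open>Raising the weight by 1 always wins here: if \<open>?w + 1\<close> were a
        nonpositive multiple of 3, then \<open>?w\<close> would be in the excluded case.\<close>
      obtain N where N: "position N |\<in>| right_opts (position M)" "total_weight N = ?w + 1"
        using right_move_up[OF False] .
      have "\<not> (total_weight N \<le> 0 \<and> total_weight N mod 3 = 0)"
        using N(2) w by presburger
      then show ?thesis using N IH_right by (subst right_wins_first.simps) blast
    qed
  qed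
qed

section \<open>Equivalence modulo the set of all positions\<close>

lemma equiv_mod_kayles_if_total_weight_eq:
  assumes "total_weight M = total_weight N"
  shows "equiv_mod kayles (position M) (position N)"
proof -
  have "misere_outcome (position M + position X) = misere_outcome (position N + position X)" for X
    using assms unfolding position_union[symmetric] misere_outcome_def first_player_wins_position
    by (simp add: total_weight_union)
  then show ?thesis by (auto simp: equiv_mod_def kayles_def position_def)
qed

text \<open>The strips of lengths 1 and 2 have weights 1 and -1, so the sum on the right has weight
  \<open>int a - int b\<close>. Each case of the theorem becomes a computation of one
  weight.\<close>

lemma equiv_mod_kayles_strip:
  assumes "weight n = int a - int b"
  shows "equiv_mod kayles (strip n) (copies a (strip 1) + copies b (strip 2))"
  using equiv_mod_kayles_if_total_weight_eq[of "{#n#}" "replicate_mset a 1 + replicate_mset b 2"]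
    assms
  by (simp add: position_union position_replicate total_weight_union total_weight_replicate)

theorem theorem3p2:
  fixes n k :: nat
  assumes "3 \<le> n"
  shows "(n = 3 * k \<longrightarrow>
            equiv_mod kayles (strip n) (copies k (strip 1) + copies k (strip 2))) \<and>
         (n = 3 * k + 1 \<longrightarrow>
            equiv_mod kayles (strip n) (copies (k + 1) (strip 1) + copies k (strip 2))) \<and>
         (n = 3 * k + 2 \<longrightarrow>
            equiv_mod kayles (strip n) (copies k (strip 1) + copies (k + 1) (strip 2)))"
proof (intro conjI impI equiv_mod_kayles_strip)
  show "weight n = int k - int k" if "n = 3 * k"
    using that unfolding weight_def by presburger
  show "weight n = int (k + 1) - int k" if "n = 3 * k + 1"
    using that unfolding weight_def by presburger
  show "weight n = int k - int (k + 1)" if "n = 3 * k + 2"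
    using that unfolding weight_def by presburger
qed

end
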